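(* Let $n\in\mathbb{N}$ (a positive integer) and let $c>0$ be real. Then the function $$\psi_{n,c}(x)=\sum_{k=0}^{\infty}\left(p_{n,k}^{[c]}(x)\right)^2,\quad x\geq 0,$$ is logarithmically convex.
   Context: For $n\in\mathbb{N}$, $k\in\mathbb{N}\cup\{0\}$ and real $c>0$, the (generalized) Baskakov basis functions are $$p_{n,k}^{[c]}(x)=\binom{-n/c}{k}(-cx)^k(1+cx)^{-n/c-k},\quad x\geq 0,$$ where $\binom{a}{k}=\frac{a(a-1)\cdots(a-k+1)}{k!}$ is the generalized binomial coefficient and $0^0=1$. A positive function $f$ on $[0,\infty)$ is logarithmically convex if $\log f$ is convex on $[0,\infty)$. *)

theory Defs
  imports "HOL-Analysis.Analysis"
begin

text \<open>
  Only meant for \<open>c > 0\<close> and \<open>x \<ge> 0\<close>, where the base \<open>1 + c * x\<close> of the real power is positive.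
\<close>

definition baskakov :: "real \<Rightarrow> nat \<Rightarrow> nat \<Rightarrow> real \<Rightarrow> real" where
  "baskakov c n k x =
     ((- real n / c) gchoose k) * (- c * x) ^ k * (1 + c * x) powr (- real n / c - real k)"

text \<open>
  An infinite sum is meaningful only where the series converges; the theorem therefore
  asserts the convergence explicitly.
\<close>

definition baskakov_square_sum :: "nat \<Rightarrow> real \<Rightarrow> real \<Rightarrow> real" where
  "baskakov_square_sum n c x = (\<Sum>k. (baskakov c n k x)\<^sup>2)"

definition log_convex_on :: "real set \<Rightarrow> (real \<Rightarrow> real) \<Rightarrow> bool" where
  "log_convex_on S f \<longleftrightarrow> (\<forall>x\<in>S. f x > 0) \<and> convex_on S (\<lambda>x. ln (f x))"

end

theory Submission
  imports Defs
begin

text \<open>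
  With \<open>a = n / c\<close> and \<open>y = c * x\<close> the sum is
  \<open>(1 + y) powr (-2 * a) * (\<Sum>k. ((a)\<^sub>k / k!)\<^sup>2 * (y / (1 + y)) ^ (2 * k))\<close>.
  Writing \<open>(1 + y) powr (-2 * a - 2 * k)\<close> as a Gamma integral turns it, up to the factor
  \<open>Gamma (2 * a)\<close>, into the integral of
  \<open>u powr (2 * a - 1) * exp (- u) * exp (- u * y) * H (u * y)\<close> over \<open>u > 0\<close>, where by
  the duplication formula \<open>H z\<close> is the series with coefficients
  \<open>(1/2)\<^sub>k * (a)\<^sub>k / ((1)\<^sub>k * (a + 1/2)\<^sub>k * (2 * k)!)\<close> at \<open>z ^ (2 * k)\<close>. The quotients
  \<open>(1/2)\<^sub>k / (1)\<^sub>k\<close> and \<open>(a)\<^sub>k / (a + 1/2)\<^sub>k\<close> are moments of Beta distributions, so \<open>H\<close>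
  is a mixture of functions \<open>z \<mapsto> cosh (r * z)\<close>, and the whole sum is a mixture of
  exponentials. Mixtures of log-convex functions are log-convex.
\<close>

section \<open>Tilted convexity and its closure under mixtures\<close>

text \<open>
  For positive functions this is equivalent to log-convexity, but it is linear in \<open>f\<close>, so that it
  passes through sums and integrals at once.
\<close>

definition tilt_convex :: "(real \<Rightarrow> real) \<Rightarrow> bool" where
  "tilt_convex f \<longleftrightarrow> (\<forall>s. convex_on {0..} (\<lambda>x. exp (s * x) * f x))"

lemma tilt_convexD:
  assumes "tilt_convex f" "0 \<le> t" "t \<le> 1" "0 \<le> x" "0 \<le> y"
  shows "exp (s * ((1 - t) * x + t * y)) * f ((1 - t) * x + t * y)
    \<le> (1 - t) * (exp (s * x) * f x) + t * (exp (s * y) * f y)"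
  using convex_onD[of "{0..}" "\<lambda>x. exp (s * x) * f x" t x y] assms
  by (auto simp: tilt_convex_def)

lemma tilt_convexI:
  assumes "\<And>s t x y. 0 < t \<Longrightarrow> t < 1 \<Longrightarrow> 0 \<le> x \<Longrightarrow> 0 \<le> y \<Longrightarrow>
    exp (s * ((1 - t) * x + t * y)) * f ((1 - t) * x + t * y)
      \<le> (1 - t) * (exp (s * x) * f x) + t * (exp (s * y) * f y)"
  shows "tilt_convex f"
  unfolding tilt_convex_def by (intro allI convex_onI) (use assms in auto)

lemma tilt_convex_exp: "tilt_convex (\<lambda>x. exp (b * x))"
proof -
  have "convex_on {0..} (\<lambda>x. exp (l * x))" for l :: real
    by (rule convex_on_realI[where f' = "\<lambda>x. l * exp (l * x)"])
       (auto intro!: derivative_eq_intros simp: mult_le_cancel_left mult_left_mono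
         mult_left_mono_neg split: if_splits)
  then show ?thesis
    by (simp add: tilt_convex_def flip: exp_add distrib_right)
qed

lemma tilt_convex_add: "tilt_convex f \<Longrightarrow> tilt_convex g \<Longrightarrow> tilt_convex (\<lambda>x. f x + g x)"
  by (auto simp: tilt_convex_def distrib_left)

lemma tilt_convex_cmult: "tilt_convex f \<Longrightarrow> 0 \<le> c \<Longrightarrow> tilt_convex (\<lambda>x. c * f x)"
  unfolding tilt_convex_def by (auto simp: mult.left_commute[of _ c])

text \<open>For \<open>c > 0\<close>, tilting the dilated function by \<open>s\<close> amounts to
  tilting \<open>f\<close> by \<open>s / c\<close>. For \<open>c = 0\<close> the function is the
  constant \<open>f 0\<close>, whose tilts are convex because \<open>f 0\<close> is
  nonnegative.\<close>

lemma tilt_convex_scale: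
  assumes "tilt_convex f" "0 \<le> c" "0 \<le> f 0"
  shows "tilt_convex (\<lambda>x. f (c * x))"
proof (cases "c = 0")
  case True
  then show ?thesis
    using tilt_convex_cmult[OF tilt_convex_exp[of 0] assms(3)] by simp
next
  case False
  show ?thesis
  proof (rule tilt_convexI)
    fix s t x y :: real assume "0 < t" "t < 1" "0 \<le> x" "0 \<le> y"
    then show "exp (s * ((1 - t) * x + t * y)) * f (c * ((1 - t) * x + t * y))
      \<le> (1 - t) * (exp (s * x) * f (c * x)) + t * (exp (s * y) * f (c * y))"
      using tilt_convexD[OF assms(1), of t "c * x" "c * y" "s / c"] False assms(2)
      by (simp add: algebra_simps)
  qed
qed

lemma tilt_convex_cong:
  assumes "tilt_convex f" "\<And>x. 0 \<le> x \<Longrightarrow> f x = g x"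
  shows "tilt_convex g"
proof (rule tilt_convexI)
  fix s t x y :: real assume H: "0 < t" "t < 1" "0 \<le> x" "0 \<le> y"
  then have "0 \<le> (1 - t) * x + t * y" by simp
  with H tilt_convexD[OF assms(1), of t x y s] assms(2)
  show "exp (s * ((1 - t) * x + t * y)) * g ((1 - t) * x + t * y)
      \<le> (1 - t) * (exp (s * x) * g x) + t * (exp (s * y) * g y)"
    by simp
qed

text \<open>A tilt adds a linear term to \<open>ln f\<close>, which does not affect its convexity.
  Once the tilted values at \<open>x\<close> and \<open>y\<close> agree, the chord bound is their
  common value and survives taking logarithms.\<close>

lemma log_convex_on_if_tilt_convex:
  assumes "tilt_convex f" "\<And>x. 0 \<le> x \<Longrightarrow> 0 < f x"
  shows "log_convex_on {0..} f"
  unfolding log_convex_on_def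
proof (intro conjI convex_on_linorderI)
  fix t x y :: real assume H: "0 < t" "t < 1" "x \<in> {0..}" "y \<in> {0..}" "x < y"
  define z where "z = (1 - t) * x + t * y"
  \<comment> \<open>The slope of the tilt is chosen so that the tilted function takes equal values at x and y.\<close>
  define s where "s = (ln (f x) - ln (f y)) / (y - x)"
  have s: "s * y + ln (f y) = s * x + ln (f x)"
    using H by (simp add: s_def field_simps)
  have e: "exp (s * w) * f w = exp (s * w + ln (f w))" if "0 \<le> w" for w
    using assms(2)[OF that] by (simp add: exp_add)
  have "0 \<le> z" using H by (simp add: z_def)
  have "exp (s * z) * f z \<le> (1 - t) * (exp (s * x) * f x) + t * (exp (s * y) * f y)"
    using tilt_convexD[OF assms(1), of t x y s] H by (simp add: z_def)
  also have "\<dots> = exp (s * x + ln (f x))"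
  proof -
    have "exp (s * y) * f y = exp (s * x) * f x"
      using H e[of x] e[of y] by (simp add: s)
    then show ?thesis
      using H e[of x] by (simp add: algebra_simps)
  qed
  finally have "s * z + ln (f z) \<le> s * x + ln (f x)"
    using e[OF \<open>0 \<le> z\<close>] by simp
  moreover have "s * x + ln (f x) = (1 - t) * (s * x + ln (f x)) + t * (s * y + ln (f y))"
    by (simp add: s algebra_simps)
  ultimately show "ln (f ((1 - t) *\<^sub>R x + t *\<^sub>R y)) \<le> (1 - t) * ln (f x) + t * ln (f y)"
    by (simp add: z_def algebra_simps)
qed (use assms in auto)

text \<open>The inequality defining tilted convexity is linear in the function, so it may be
  integrated over \<open>u\<close>. Only the integrals of the single terms are supplied;
  integrability of their sum follows from the convergence of the series of
  \<open>t k x\<close>.\<close>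

lemma tilt_convex_mixture:
  fixes g :: "nat \<Rightarrow> real \<Rightarrow> 'b::euclidean_space \<Rightarrow> real"
  assumes nonneg: "\<And>k x u. 0 \<le> x \<Longrightarrow> u \<in> A \<Longrightarrow> 0 \<le> g k x u"
    and int: "\<And>k x. 0 \<le> x \<Longrightarrow> (g k x has_integral t k x) A"
    and G: "\<And>x u. 0 \<le> x \<Longrightarrow> u \<in> A \<Longrightarrow> (\<lambda>k. g k x u) sums G x u"
    and T: "\<And>x. 0 \<le> x \<Longrightarrow> (\<lambda>k. t k x) sums T x"
    and conv: "\<And>u. u \<in> A \<Longrightarrow> tilt_convex (\<lambda>x. G x u)"
  shows "tilt_convex T"
proof (rule tilt_convexI)
  \<comment> \<open>Sum and integral are exchanged by monotone convergence: the partial sums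
    increase since the terms are nonnegative, and their integrals converge, hence are
    bounded.\<close>
  have *: "(G x has_integral T x) A" if x: "0 \<le> x" for x
  proof -
    have p: "((\<lambda>u. \<Sum>k<N. g k x u) has_integral (\<Sum>k<N. t k x)) A" for N
      using x by (intro has_integral_sum int) auto
    then have p': "(\<lambda>N. integral A (\<lambda>u. \<Sum>k<N. g k x u)) = (\<lambda>N. \<Sum>k<N. t k x)"
      by (auto simp: integral_unique)
    have l: "(\<lambda>N. \<Sum>k<N. t k x) \<longlonglongrightarrow> T x"
      using T[OF x] by (simp add: sums_def)
    have "G x integrable_on A \<and> (\<lambda>N. integral A (\<lambda>u. \<Sum>k<N. g k x u)) \<longlonglongrightarrow> integral A (G x)"
    proof (rule monotone_convergence_increasing)
      show "bounded (range (\<lambda>N. integral A (\<lambda>u. \<Sum>k<N. g k x u)))"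
        unfolding p' using l by (intro convergent_imp_bounded)
    qed (use p nonneg x G[OF x] in \<open>auto simp: sums_def\<close>)
    then show ?thesis
      unfolding p' using l LIMSEQ_unique by (auto simp: has_integral_iff)
  qed
  fix s r x y :: real assume H: "0 < r" "r < 1" "0 \<le> x" "0 \<le> y"
  then have z: "0 \<le> (1 - r) * x + r * y" by simp
  show "exp (s * ((1 - r) * x + r * y)) * T ((1 - r) * x + r * y)
      \<le> (1 - r) * (exp (s * x) * T x) + r * (exp (s * y) * T y)"
  proof (rule has_integral_le)
    show "((\<lambda>u. exp (s * ((1 - r) * x + r * y)) * G ((1 - r) * x + r * y) u) has_integral
        exp (s * ((1 - r) * x + r * y)) * T ((1 - r) * x + r * y)) A"
      by (intro has_integral_mult_right * z)
    show "((\<lambda>u. (1 - r) * (exp (s * x) * G x u) + r * (exp (s * y) * G y u)) has_integral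
        (1 - r) * (exp (s * x) * T x) + r * (exp (s * y) * T y)) A"
      by (intro has_integral_add has_integral_mult_right * H)
  qed (use H in \<open>auto intro: tilt_convexD[OF conv]\<close>)
qed

section \<open>Mixing the hyperbolic cosine with Beta distributions\<close>

lemma cosh_sums_even: "(\<lambda>k. x ^ (2 * k) / fact (2 * k)) sums cosh (x::real)"
proof -
  have "(\<lambda>k. if even (2 * k) then x ^ (2 * k) /\<^sub>R fact (2 * k) else 0) sums cosh x"
    by (subst sums_mono_reindex[of "\<lambda>k. 2 * k"])
       (use cosh_converges[of x] in \<open>auto simp: strict_mono_def elim!: evenE\<close>)
  then show ?thesis by (simp add: field_simps)
qed

lemma tilt_convex_cosh: "tilt_convex cosh"
proof -
  have "tilt_convex (\<lambda>x. 1/2 * (exp (1 * x) + exp ((-1) * x)))"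
    by (intro tilt_convex_cmult tilt_convex_add tilt_convex_exp) auto
  then show ?thesis
    by (rule tilt_convex_cong) (simp add: cosh_def)
qed

lemma pochhammer_mono_real:
  fixes a b :: real
  assumes "0 < a" "a \<le> b"
  shows "pochhammer a k \<le> pochhammer b k"
  using assms
  by (induction k) (auto simp: pochhammer_Suc intro!: mult_mono pochhammer_nonneg)

text \<open>By the functional equation of Gamma. After division by \<open>Beta a b\<close> these are
  the moments of the Beta distribution.\<close>

lemma Beta_add_nat:
  fixes a b :: real
  assumes "0 < a" "0 < b"
  shows "Beta (a + real k) b = Beta a b * (pochhammer a k / pochhammer (a + b) k)"
proof -
  have [simp]: "a \<notin> \<int>\<^sub>\<le>\<^sub>0" "a + b \<notin> \<int>\<^sub>\<le>\<^sub>0"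
    using assms by (auto elim!: nonpos_Ints_cases)
  have "Gamma (a + b) \<noteq> 0" "Gamma a \<noteq> 0"
    by (auto simp: Gamma_eq_zero_iff)
  then show ?thesis
    using assms by (simp add: Beta_def pochhammer_Gamma add_ac)
qed

text \<open>The ratio lies between 0 and 1, so the original series dominates.\<close>

lemma summable_pochhammer_ratio:
  fixes a b :: real
  assumes "0 < a" "0 < b" "\<And>k. 0 \<le> c k" "summable (\<lambda>k. c k * x ^ (2 * k))"
  shows "summable (\<lambda>k. c k * (pochhammer a k / pochhammer (a + b) k) * x ^ (2 * k))"
proof (rule summable_comparison_test'[OF assms(4)])
  fix k
  have "pochhammer a k / pochhammer (a + b) k \<le> 1"
    using assms pochhammer_mono_real[of a "a + b" k] pochhammer_pos[of "a + b" k] by simp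
  moreover have "0 \<le> pochhammer a k / pochhammer (a + b) k"
    using assms by (intro divide_nonneg_nonneg pochhammer_nonneg) auto
  ultimately show "norm (c k * (pochhammer a k / pochhammer (a + b) k) * x ^ (2 * k)) \<le> c k * x ^ (2 * k)"
    using assms(3)[of k] mult_right_mono[OF mult_left_le, of _ "c k" "x ^ (2 * k)"]
    by (subst real_norm_def, subst abs_of_nonneg) (auto simp del: times_divide_eq_right)
qed

text \<open>The ratio is a Beta moment, so inserting it averages the dilated functions at
  \<open>sqrt u * x\<close> over \<open>u\<close>. The square root appears because the series runs
  over even powers: \<open>(sqrt u) ^ (2 * k)\<close> is \<open>u ^ k\<close>.\<close>

lemma tilt_convex_pochhammer_ratio:
  fixes a b :: real
  assumes ab: "0 < a" "0 < b" and c: "\<And>k. 0 \<le> c k"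
    and sm: "\<And>x. summable (\<lambda>k. c k * x ^ (2 * k))"
    and conv: "tilt_convex (\<lambda>x. \<Sum>k. c k * x ^ (2 * k))"
  shows "tilt_convex (\<lambda>x. \<Sum>k. c k * (pochhammer a k / pochhammer (a + b) k) * x ^ (2 * k))"
proof -
  \<comment> \<open>On the unit interval, the density of the Beta distribution with parameters
    \<open>a\<close> and \<open>b\<close>.\<close>
  define w where "w u = u powr (a - 1) * (1 - u) powr (b - 1) / Beta a b" for u :: real
  have B: "0 < Beta a b" using ab by (simp add: Beta_def)
  then have w: "0 \<le> w u" for u by (simp add: w_def)
  show ?thesis
  proof (rule tilt_convex_mixture[where A = "{0..1}"
        and g = "\<lambda>k x u. w u * (c k * (sqrt u * x) ^ (2 * k))"
        and G = "\<lambda>x u. w u * (\<Sum>k. c k * (sqrt u * x) ^ (2 * k))"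
        and t = "\<lambda>k x. c k * (pochhammer a k / pochhammer (a + b) k) * x ^ (2 * k)"])
    fix k and x :: real
    have "((\<lambda>u. c k * x ^ (2 * k) / Beta a b * (u powr (a + k - 1) * (1 - u) powr (b - 1)))
      has_integral c k * x ^ (2 * k) / Beta a b * Beta (a + k) b) {0..1}"
      using ab by (intro has_integral_mult_right has_integral_Beta_real) auto
    also have "c k * x ^ (2 * k) / Beta a b * Beta (a + k) b =
        c k * (pochhammer a k / pochhammer (a + b) k) * x ^ (2 * k)"
      using ab B by (simp add: Beta_add_nat)
    finally show "((\<lambda>u. w u * (c k * (sqrt u * x) ^ (2 * k))) has_integral
        c k * (pochhammer a k / pochhammer (a + b) k) * x ^ (2 * k)) {0..1}"
    proof (rule has_integral_eq[rotated])
      fix u :: real assume u: "u \<in> {0..1}"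
      \<comment> \<open>At \<open>u = 0\<close> both sides vanish, since \<open>0 powr p\<close> is
        0 for every exponent \<open>p\<close>.\<close>
      have "u powr (a + k - 1) = u powr (a - 1) * u ^ k"
      proof (cases "u = 0")
        case False
        then have "u powr (a - 1 + k) = u powr (a - 1) * u ^ k"
          using u by (simp add: powr_add powr_realpow)
        then show ?thesis by (simp add: algebra_simps)
      qed simp
      moreover have "(sqrt u * x) ^ (2 * k) = u ^ k * x ^ (2 * k)"
        using u by (simp add: power_mult_distrib power_mult)
      ultimately show "c k * x ^ (2 * k) / Beta a b * (u powr (a + k - 1) * (1 - u) powr (b - 1))
        = w u * (c k * (sqrt u * x) ^ (2 * k))"
        by (simp add: w_def)
    qed
  next
    fix u :: real assume "u \<in> {0..1}"
    then show "tilt_convex (\<lambda>x. w u * (\<Sum>k. c k * (sqrt u * x) ^ (2 * k)))"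
      using w c sm[of 0]
      by (intro tilt_convex_cmult tilt_convex_scale[OF conv]) (auto intro!: suminf_nonneg)
  qed (use w c sm summable_pochhammer_ratio[OF ab c sm] in
      \<open>auto intro!: mult_nonneg_nonneg sums_mult summable_sums zero_le_power\<close>)
qed

section \<open>Euler's Gamma integral with a rate parameter\<close>

lemma Gamma_has_integral_scaled:
  fixes p b :: real
  assumes "0 < p" "0 < b"
  shows "((\<lambda>u. u powr (p - 1) * exp (- b * u)) has_integral Gamma p / b powr p) {0<..}"
proof -
  \<comment> \<open>The integrand of Euler's integral, extended by zero so that the substitution
    \<open>b * u\<close> can be made on the whole line.\<close>
  define h where "h u = indicator {0..} u * u powr (p - 1) / exp u" for u :: real
  have [measurable]: "h \<in> borel_measurable borel" by (simp add: h_def [abs_def])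
  have h: "0 \<le> h u" for u by (simp add: h_def)
  have "ennreal (Gamma p) = (\<integral>\<^sup>+u. ennreal (h u) \<partial>lborel)"
    using Gamma_conv_nn_integral_real[OF assms(1)] by (simp add: h_def)
  also have "\<dots> = ennreal b * (\<integral>\<^sup>+u. ennreal (h (b * u)) \<partial>lborel)"
    using nn_integral_real_affine[of "\<lambda>u. ennreal (h u)" b 0] assms by simp
  also have "\<dots> = (\<integral>\<^sup>+u. ennreal (b * h (b * u)) \<partial>lborel)"
    using assms h by (simp add: ennreal_mult nn_integral_cmult)
  finally have "((\<lambda>u. b * h (b * u)) has_integral Gamma p) UNIV"
    using assms h by (intro nn_integral_has_integral) auto
  then have "((\<lambda>u. 1 / b powr p * (b * h (b * u))) has_integral 1 / b powr p * Gamma p) UNIV"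
    by (rule has_integral_mult_right)
  \<comment> \<open>Passing to the open half-line changes nothing: at 0 the integrand has the factor
    \<open>0 powr (p - 1)\<close>, which is 0.\<close>
  then have "((\<lambda>u. if u \<in> {0<..} then u powr (p - 1) * exp (- b * u) else 0)
      has_integral Gamma p / b powr p) UNIV"
  proof (rule has_integral_eq[rotated, THEN has_integral_eq_rhs])
    fix u :: real
    have "(b * u) powr (p - 1) = b powr p / b * u powr (p - 1)" if "0 < u"
      using that assms by (simp add: powr_mult powr_diff)
    then show "1 / b powr p * (b * h (b * u))
      = (if u \<in> {0<..} then u powr (p - 1) * exp (- b * u) else 0)"
      using assms by (auto simp: h_def exp_minus field_simps indicator_def zero_le_mult_iff)
  qed simp
  then show ?thesis by (simp only: has_integral_restrict_UNIV)
qed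

text \<open>An extra exponential factor merely shifts the tilt from \<open>s\<close> to
  \<open>s + b\<close>.\<close>

lemma tilt_convex_exp_mult:
  assumes "tilt_convex f"
  shows "tilt_convex (\<lambda>x. exp (b * x) * f x)"
proof -
  have "(\<lambda>x. exp (s * x) * (exp (b * x) * f x)) = (\<lambda>x. exp ((s + b) * x) * f x)" for s
    by (simp add: exp_add algebra_simps)
  then show ?thesis
    using assms unfolding tilt_convex_def by metis
qed

section \<open>Sums of squared negative binomial weights\<close>

lemma gbinomial_minus_mult_power:
  fixes a y :: real
  shows "((- a) gchoose k) * (- y) ^ k = pochhammer a k / fact k * y ^ k"
proof -
  \<comment> \<open>The sign from writing the binomial coefficient as a rising factorial cancels the
    sign of \<open>(- y) ^ k\<close>.\<close>
  have "(- 1) ^ k * (- 1) ^ k = (1 :: real)"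
    by (simp flip: power_mult_distrib)
  then show ?thesis
    unfolding gbinomial_pochhammer power_minus[of y] by simp
qed

text \<open>This is the binomial series of \<open>((1 + y) + (- y)) powr (- a)\<close>.\<close>

lemma negative_binomial_sums:
  fixes a y :: real
  assumes "0 \<le> y"
  shows "(\<lambda>k. pochhammer a k / fact k * y ^ k * (1 + y) powr (- a - real k)) sums 1"
proof -
  have "\<bar>- y\<bar> < 1 + y" using assms by simp
  from gen_binomial_real'[OF this, of "- a"] show ?thesis
    by (simp add: gbinomial_minus_mult_power)
qed

text \<open>The weights are nonnegative with sum 1, so each is at most 1 and its square is at most
  itself.\<close>

lemma negative_binomial_squares_summable:
  fixes a y :: real
  assumes "0 < a" "0 \<le> y"
  shows "summable (\<lambda>k. (pochhammer a k / fact k * y ^ k * (1 + y) powr (- a - real k))\<^sup>2)"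
proof -
  define q where "q k = pochhammer a k / fact k * y ^ k * (1 + y) powr (- a - real k)" for k
  have q: "q sums 1" "\<And>k. 0 \<le> q k"
    using negative_binomial_sums[OF assms(2)] assms unfolding q_def
    by (auto intro!: mult_nonneg_nonneg divide_nonneg_nonneg pochhammer_nonneg)
  have "q k \<le> 1" for k
    using sum_le_suminf[of q "{k}"] q by (auto simp: sums_iff)
  then have "norm ((q k)\<^sup>2) \<le> q k" for k
    using q(2)[of k] by (simp add: power2_eq_square mult_left_le)
  then have "summable (\<lambda>k. (q k)\<^sup>2)"
    using q(1) by (auto intro!: summable_comparison_test'[of q 0] simp: sums_iff)
  then show ?thesis by (simp add: q_def)
qed

text \<open>The duplication formula is applied to \<open>fact (2 * k)\<close> and to
  \<open>pochhammer (2 * a) (2 * k)\<close>; the factors with parameters \<open>1/2\<close> and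
  \<open>a + 1/2\<close> cancel. The sum \<open>1/2 + 1/2\<close> stays unevaluated to match the
  denominators of the Beta mixtures.\<close>

lemma pochhammer_square_identity:
  fixes a :: real
  assumes "0 < a"
  shows "1 / fact (2 * k) * (pochhammer (1/2) k / pochhammer (1/2 + 1/2) k)
      * (pochhammer a k / pochhammer (a + 1/2) k) * pochhammer (2 * a) (2 * k)
    = (pochhammer a k / fact k)\<^sup>2"
proof -
  have "fact (2 * k) = 2 ^ (2 * k) * pochhammer (1/2 :: real) k * fact k"
    using pochhammer_double[of "1/2 :: real" k] by (simp add: pochhammer_fact)
  moreover have "pochhammer (1/2 :: real) k > 0" "pochhammer (a + 1/2) k > 0"
    using assms by (auto intro!: pochhammer_pos)
  moreover have "pochhammer (2 * a) (2 * k) = 2 ^ (2 * k) * pochhammer a k * pochhammer (a + 1/2) k"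
    by (simp add: pochhammer_double)
  ultimately show ?thesis
    by (simp add: power2_eq_square pochhammer_fact[symmetric] field_simps)
qed

lemma tilt_convex_negative_binomial_squares:
  fixes a :: real
  assumes a: "0 < a"
  shows "tilt_convex (\<lambda>y. \<Sum>k. (pochhammer a k / fact k * y ^ k * (1 + y) powr (- a - real k))\<^sup>2)"
proof -
  define q where "q k y = pochhammer a k / fact k * y ^ k * (1 + y) powr (- a - real k)"
    for k and y :: real
  \<comment> \<open>\<open>d1\<close> and \<open>d\<close> arise from the coefficients of
    \<open>cosh\<close> by Beta mixtures with parameters \<open>(1/2, 1/2)\<close> and then
    \<open>(a, 1/2)\<close>.\<close>
  define d1 :: "nat \<Rightarrow> real"
    where "d1 k = 1 / fact (2 * k) * (pochhammer (1/2) k / pochhammer (1/2 + 1/2) k)" for k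
  define d where "d k = d1 k * (pochhammer a k / pochhammer (a + 1/2) k)" for k
  have d1: "0 \<le> d1 k" for k
    unfolding d1_def by (intro mult_nonneg_nonneg divide_nonneg_nonneg pochhammer_nonneg) auto
  have d: "0 \<le> d k" for k
    using d1 a unfolding d_def by (intro mult_nonneg_nonneg divide_nonneg_nonneg pochhammer_nonneg) auto
  have sm0: "summable (\<lambda>k. 1 / fact (2 * k) * x ^ (2 * k))" for x :: real
    using cosh_sums_even[of x] by (simp add: sums_iff)
  have sm1: "summable (\<lambda>k. d1 k * x ^ (2 * k))" for x
    unfolding d1_def by (intro summable_pochhammer_ratio sm0) auto
  have sm: "summable (\<lambda>k. d k * x ^ (2 * k))" for x
    unfolding d_def by (intro summable_pochhammer_ratio sm1 d1 a) auto
  have "tilt_convex (\<lambda>x. \<Sum>k. 1 / fact (2 * k) * x ^ (2 * k))"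
    using tilt_convex_cosh by (rule tilt_convex_cong) (use cosh_sums_even in \<open>simp add: sums_iff\<close>)
  then have "tilt_convex (\<lambda>x. \<Sum>k. d1 k * x ^ (2 * k))"
    unfolding d1_def by (intro tilt_convex_pochhammer_ratio sm0) auto
  then have conv: "tilt_convex (\<lambda>x. \<Sum>k. d k * x ^ (2 * k))"
    unfolding d_def by (intro tilt_convex_pochhammer_ratio sm1 a d1) auto
  have G: "0 < Gamma (2 * a)" using a by simp
  \<comment> \<open>The factor \<open>Gamma (2 * a)\<close> is what the Gamma integral produces; it
    is divided out at the end.\<close>
  have "tilt_convex (\<lambda>y. Gamma (2 * a) * (\<Sum>k. (q k y)\<^sup>2))"
  proof (rule tilt_convex_mixture[where A = "{0<..}"
        and g = "\<lambda>k y u. u powr (2 * a - 1) * exp (- (1 + y) * u) * (d k * (u * y) ^ (2 * k))"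
        and G = "\<lambda>y u. u powr (2 * a - 1) * exp (- u) * (exp (- u * y) * (\<Sum>k. d k * (u * y) ^ (2 * k)))"
        and t = "\<lambda>k y. Gamma (2 * a) * (q k y)\<^sup>2"])
    fix k and y :: real assume y: "0 \<le> y"
    \<comment> \<open>The factor \<open>u ^ (2 * k)\<close> raises the Gamma parameter from
      \<open>2 * a\<close> to \<open>p\<close>, and \<open>(1 + y) powr (- p)\<close> is the square
      of the power in \<open>q k y\<close>.\<close>
    define p where "p = 2 * a + real (2 * k)"
    have "((\<lambda>u. d k * y ^ (2 * k) * (u powr (p - 1) * exp (- (1 + y) * u)))
        has_integral d k * y ^ (2 * k) * (Gamma p / (1 + y) powr p)) {0<..}"
      using a y by (intro has_integral_mult_right Gamma_has_integral_scaled) (auto simp: p_def)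
    moreover have "d k * y ^ (2 * k) * (Gamma p / (1 + y) powr p) = Gamma (2 * a) * (q k y)\<^sup>2"
    proof -
      have "2 * a \<notin> \<int>\<^sub>\<le>\<^sub>0" using a by (auto elim!: nonpos_Ints_cases)
      then have "Gamma p = Gamma (2 * a) * pochhammer (2 * a) (2 * k)"
        using G by (simp add: pochhammer_Gamma p_def)
      moreover have "d k * pochhammer (2 * a) (2 * k) = (pochhammer a k / fact k)\<^sup>2"
        unfolding d_def d1_def by (rule pochhammer_square_identity[OF a])
      moreover have "((1 + y) powr (- a - real k))\<^sup>2 = 1 / (1 + y) powr p"
        by (simp add: p_def power2_eq_square algebra_simps flip: powr_add powr_minus_divide)
      ultimately show ?thesis
        unfolding q_def power_mult_distrib power_mult[symmetric] by (simp add: mult_ac)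
    qed
    ultimately have "((\<lambda>u. d k * y ^ (2 * k) * (u powr (p - 1) * exp (- (1 + y) * u)))
        has_integral Gamma (2 * a) * (q k y)\<^sup>2) {0<..}" by simp
    then show "((\<lambda>u. u powr (2 * a - 1) * exp (- (1 + y) * u) * (d k * (u * y) ^ (2 * k)))
        has_integral Gamma (2 * a) * (q k y)\<^sup>2) {0<..}"
    proof (rule has_integral_eq[rotated])
      fix u :: real assume "u \<in> {0<..}"
      then have "u powr (p - 1) = u powr (2 * a - 1) * u ^ (2 * k)"
        by (simp add: p_def powr_realpow[symmetric] algebra_simps flip: powr_add)
      then show "d k * y ^ (2 * k) * (u powr (p - 1) * exp (- (1 + y) * u))
        = u powr (2 * a - 1) * exp (- (1 + y) * u) * (d k * (u * y) ^ (2 * k))"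
        by (simp add: power_mult_distrib)
    qed
  next
    fix y u :: real
    \<comment> \<open>The first factor joins the weight at \<open>u\<close>; the second depends on
      \<open>y\<close> and only shifts the tilt.\<close>
    have "exp (- (1 + y) * u) = exp (- u) * exp (- u * y)"
      by (simp add: algebra_simps flip: exp_add)
    then show "(\<lambda>k. u powr (2 * a - 1) * exp (- (1 + y) * u) * (d k * (u * y) ^ (2 * k))) sums
      (u powr (2 * a - 1) * exp (- u) * (exp (- u * y) * (\<Sum>k. d k * (u * y) ^ (2 * k))))"
      using sums_mult[OF summable_sums[OF sm[of "u * y"]],
          of "u powr (2 * a - 1) * exp (- (1 + y) * u)"]
      by (simp add: mult_ac)
  next
    \<comment> \<open>For fixed \<open>u\<close> this is a dilation of the twofold Beta mixture of
      \<open>cosh\<close>, times an exponential in \<open>y\<close> and a nonnegative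
      constant.\<close>
    fix u :: real assume "u \<in> {0<..}"
    then show "tilt_convex (\<lambda>y. u powr (2 * a - 1) * exp (- u)
        * (exp (- u * y) * (\<Sum>k. d k * (u * y) ^ (2 * k))))"
      using d sm[of 0]
      by (intro tilt_convex_cmult tilt_convex_exp_mult tilt_convex_scale[OF conv])
         (auto intro!: suminf_nonneg)
  next
    fix y :: real assume "0 \<le> y"
    then show "(\<lambda>k. Gamma (2 * a) * (q k y)\<^sup>2) sums (Gamma (2 * a) * (\<Sum>k. (q k y)\<^sup>2))"
      unfolding q_def by (intro sums_mult summable_sums negative_binomial_squares_summable a)
  qed (use d in auto)
  from tilt_convex_cmult[OF this, of "1 / Gamma (2 * a)"] G show ?thesis
    by (simp add: q_def)
qed

section \<open>Specialisation to the Baskakov basis\<close>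

lemma baskakov_eq:
  "baskakov c n k x = pochhammer (real n / c) k / fact k * (c * x) ^ k
     * (1 + c * x) powr (- (real n / c) - real k)"
  using gbinomial_minus_mult_power[of "real n / c" k "c * x"] by (simp add: baskakov_def)

theorem corollary2p1:
  fixes n :: nat and c :: real
  assumes "n \<ge> 1" and "c > 0"
  shows "(\<forall>x\<ge>0. summable (\<lambda>k. (baskakov c n k x)\<^sup>2)) \<and>
         log_convex_on {0..} (baskakov_square_sum n c)"
proof (intro conjI allI impI)
  have a: "0 < real n / c" using assms by simp
  show sm: "summable (\<lambda>k. (baskakov c n k x)\<^sup>2)" if "0 \<le> x" for x
    unfolding baskakov_eq using that assms a by (intro negative_binomial_squares_summable) auto
  show "log_convex_on {0..} (baskakov_square_sum n c)"
  proof (rule log_convex_on_if_tilt_convex)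
    show "tilt_convex (baskakov_square_sum n c)"
      unfolding baskakov_square_sum_def [abs_def] baskakov_eq
      \<comment> \<open>The dilation is \<open>y = c * x\<close>; the value at 0 is nonnegative as a
        sum of squares.\<close>
      by (rule tilt_convex_scale[OF tilt_convex_negative_binomial_squares[OF a]])
         (use assms negative_binomial_squares_summable[OF a order.refl] in
            \<open>auto intro!: suminf_nonneg simp del: power_0_left\<close>)
    show "0 < baskakov_square_sum n c x" if "0 \<le> x" for x
    proof -
      have "0 < 1 + c * x" using that assms by (simp add: add_pos_nonneg)
      \<comment> \<open>The term with \<open>k = 0\<close> is the square of a power of
        \<open>1 + c * x\<close>, hence strictly positive, also at \<open>x = 0\<close>.\<close>
      then have "0 < (baskakov c n 0 x)\<^sup>2" by (simp add: baskakov_eq)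
      then show ?thesis
        unfolding baskakov_square_sum_def by (intro suminf_pos2[OF sm[OF that], of 0]) auto
    qed
  qed
qed

end
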